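(* Let $n\ge1$ be an integer. The Radon transform is injective on the symmetric group $S_n$ if and only if $n\geq3$.
   Context: For a finite group $G$ and $m\ge 2$ let $C_m$ be the cyclic group of order $m$, and let $\Gamma_m$ be the set of nontrivial homomorphisms $C_m\to G$. For $f:G\to\mathbb{C}$, $x\in G$ and $\gamma\in\Gamma_m$ put $R_mf(x,\gamma)=\sum_{t\in C_m}f(x\gamma(t))$. The Radon transform on $G$ is $Rf=(R_mf)_{m\ge2}$; it is injective on $G$ if the only $f:G\to\mathbb{C}$ with $R_mf=0$ for all $m\ge2$ is $f=0$. *)

theory Defs
  imports Complex_Main "HOL-Algebra.Sym_Groups" "HOL-Algebra.Elementary_Groups"
begin

(* The cyclic group C_m is integer_mod_group m, i.e. {0..<m} under addition mod m (for m >= 1).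
   Members of hom are total functions whose values off the carrier are arbitrary; radon
   evaluates them on the carrier of C_m only. *)
definition nontrivial_homs :: "nat \<Rightarrow> ('a, 'b) monoid_scheme \<Rightarrow> (int \<Rightarrow> 'a) set" where
  "nontrivial_homs m G =
     {\<gamma> \<in> hom (integer_mod_group m) G. \<exists>t\<in>carrier (integer_mod_group m). \<gamma> t \<noteq> \<one>\<^bsub>G\<^esub>}"

definition radon ::
  "('a, 'b) monoid_scheme \<Rightarrow> nat \<Rightarrow> ('a \<Rightarrow> complex) \<Rightarrow> 'a \<Rightarrow> (int \<Rightarrow> 'a) \<Rightarrow> complex" where
  "radon G m f x \<gamma> = (\<Sum>t\<in>carrier (integer_mod_group m). f (x \<otimes>\<^bsub>G\<^esub> \<gamma> t))"

(* Functions G -> C are total functions considered on carrier G only,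
   so the zero function means vanishing on carrier G. *)
definition radon_injective :: "('a, 'b) monoid_scheme \<Rightarrow> bool" where
  "radon_injective G \<longleftrightarrow>
     (\<forall>f :: 'a \<Rightarrow> complex.
        (\<forall>m\<ge>2. \<forall>x\<in>carrier G. \<forall>\<gamma>\<in>nontrivial_homs m G. radon G m f x \<gamma> = 0)
        \<longrightarrow> (\<forall>x\<in>carrier G. f x = 0))"

end

theory Submission imports Defs begin

text \<open>
  The two directions come from two general facts about a group \<open>G\<close>.

  Let \<open>\<chi>\<close> be a faithful linear character of \<open>G\<close>. Every nontrivial homomorphism
  \<open>\<gamma>\<close> from a finite cyclic group pulls \<open>\<chi>\<close> back to a nontrivial character, whose values
  sum to \<open>0\<close>; hence \<open>\<chi>\<close> itself lies in the kernel of the Radon transform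
  (\<open>not_radon_injective_if_faithful_character\<close>). On \<open>S_1\<close> and \<open>S_2\<close> the sign is such a
  character.

  If on the other hand \<open>G\<close> contains involutions \<open>s\<close>, \<open>u\<close> whose product has order \<open>3\<close>,
  that is a copy of \<open>S_3\<close>, let \<open>f\<close> be in the kernel. The subgroups generated by \<open>s\<close> and
  by \<open>u\<close> give \<open>f (x s) = - f x\<close> and \<open>f (x u) = - f x\<close> for all \<open>x\<close>, so \<open>f\<close> takes the same
  value at \<open>x\<close>, \<open>x s u\<close> and \<open>x u s\<close>. As \<open>u s\<close> is the square of \<open>s u\<close>, these three points
  form a coset of the subgroup generated by \<open>s u\<close>, and therefore \<open>3 f x = 0\<close>
  (\<open>radon_injective_if_involutions\<close>). The transpositions \<open>(1 2)\<close> and \<open>(2 3)\<close> serve as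
  \<open>s\<close> and \<open>u\<close> as soon as \<open>n \<ge> 3\<close>.
\<close>

text \<open>
  The sum is invariant under translation by an element \<open>a\<close> with \<open>\<psi> a \<noteq> 1\<close>, but translation
  also multiplies it by \<open>\<psi> a\<close>.
\<close>

lemma (in group) sum_nontrivial_character_eq_0:
  fixes \<psi> :: "'a \<Rightarrow> complex"
  assumes mult: "\<And>x y. x \<in> carrier G \<Longrightarrow> y \<in> carrier G \<Longrightarrow> \<psi> (x \<otimes> y) = \<psi> x * \<psi> y"
    and a: "a \<in> carrier G" "\<psi> a \<noteq> 1"
  shows "(\<Sum>t\<in>carrier G. \<psi> t) = 0"
proof -
  have "(\<Sum>t\<in>carrier G. \<psi> t) = (\<Sum>t\<in>(\<lambda>t. a \<otimes> t) ` carrier G. \<psi> t)"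
    using a by (simp add: surj_const_mult)
  also have "\<dots> = (\<Sum>t\<in>carrier G. \<psi> (a \<otimes> t))"
    using a by (simp add: sum.reindex inj_on_cmult)
  also have "\<dots> = \<psi> a * (\<Sum>t\<in>carrier G. \<psi> t)"
    using a by (simp add: mult sum_distrib_left)
  finally show ?thesis
    using a by (metis mult_cancel_right1)
qed

lemma not_radon_injective_if_faithful_character:
  fixes \<chi> :: "'a \<Rightarrow> complex"
  assumes G: "group G"
    and mult: "\<And>x y. x \<in> carrier G \<Longrightarrow> y \<in> carrier G \<Longrightarrow> \<chi> (x \<otimes>\<^bsub>G\<^esub> y) = \<chi> x * \<chi> y"
    and faithful: "\<And>x. x \<in> carrier G \<Longrightarrow> \<chi> x = 1 \<Longrightarrow> x = \<one>\<^bsub>G\<^esub>"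
    and nonzero: "\<chi> \<one>\<^bsub>G\<^esub> \<noteq> 0"
  shows "\<not> radon_injective G"
proof -
  interpret group G by (fact G)
  have "radon G m \<chi> x \<gamma> = 0"
    if x: "x \<in> carrier G" and \<gamma>: "\<gamma> \<in> nontrivial_homs m G" for m x \<gamma>
  proof -
    let ?C = "integer_mod_group m"
    have hom: "\<gamma> \<in> hom ?C G"
      using \<gamma> by (simp add: nontrivial_homs_def)
    obtain a where a: "a \<in> carrier ?C" "\<gamma> a \<noteq> \<one>\<^bsub>G\<^esub>"
      using \<gamma> by (auto simp: nontrivial_homs_def)
    have closed: "\<gamma> t \<in> carrier G" if "t \<in> carrier ?C" for t
      using hom that by (rule hom_in_carrier)
    have "(\<Sum>t\<in>carrier ?C. \<chi> (\<gamma> t)) = 0"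
    proof (rule group.sum_nontrivial_character_eq_0 [OF group_integer_mod_group _ a(1)])
      show "\<chi> (\<gamma> (t \<otimes>\<^bsub>?C\<^esub> u)) = \<chi> (\<gamma> t) * \<chi> (\<gamma> u)"
        if "t \<in> carrier ?C" "u \<in> carrier ?C" for t u
        using that by (simp only: hom_mult [OF hom] mult closed)
      show "\<chi> (\<gamma> a) \<noteq> 1"
        using faithful closed a by blast
    qed
    then show ?thesis
      using x by (simp add: radon_def mult closed flip: sum_distrib_left)
  qed
  then show ?thesis
    using nonzero unfolding radon_injective_def by blast
qed

text \<open>
  The homomorphisms out of cyclic groups enter the injectivity proof only through the power maps
  \<open>t \<mapsto> g [^] t\<close>, for which the Radon transform is a sum over a coset of the subgroup
  generated by \<open>g\<close>.
\<close>

lemma (in group) sum_over_powers_eq_0: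
  fixes m :: nat and f :: "'a \<Rightarrow> complex"
  assumes kernel: "\<And>m x \<gamma>. m \<ge> 2 \<Longrightarrow> x \<in> carrier G \<Longrightarrow> \<gamma> \<in> nontrivial_homs m G \<Longrightarrow>
      radon G m f x \<gamma> = 0"
    and g: "g \<in> carrier G" "g \<noteq> \<one>" "g [^] m = \<one>"
    and m: "m \<ge> 2" and x: "x \<in> carrier G"
  shows "(\<Sum>i<m. f (x \<otimes> g [^] i)) = 0"
proof -
  define \<gamma> where "\<gamma> = (\<lambda>t::int. g [^] t)"
  have mod: "g [^] (t mod int m) = g [^] t" for t :: int
  proof -
    have "g [^] t = g [^] (int m * (t div int m) + t mod int m)"
      by simp
    also have "\<dots> = (g [^] int m) [^] (t div int m) \<otimes> g [^] (t mod int m)"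
      using g by (simp only: int_pow_mult int_pow_pow)
    also have "g [^] int m = \<one>"
      using g by (simp add: int_pow_int)
    finally show ?thesis
      using g by simp
  qed
  have "\<gamma> \<in> hom (integer_mod_group m) G"
    using g by (auto simp: hom_def \<gamma>_def mod int_pow_mult)
  moreover have "1 \<in> carrier (integer_mod_group m)" "\<gamma> 1 \<noteq> \<one>"
    using g m by (auto simp: \<gamma>_def)
  ultimately have "\<gamma> \<in> nontrivial_homs m G"
    unfolding nontrivial_homs_def by blast
  then have "radon G m f x \<gamma> = 0"
    using kernel m x by blast
  moreover have "carrier (integer_mod_group m) = int ` {..<m}"
    using m by (auto simp: carrier_integer_mod_group image_int_atLeastLessThan lessThan_atLeast0)
  ultimately show ?thesis
    by (simp add: radon_def \<gamma>_def sum.reindex int_pow_int)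
qed

text \<open>
  For distinct involutions, the braid relation \<open>s u s = u s u\<close> is equivalent to \<open>s u\<close> having
  order \<open>3\<close>. In this form it also yields directly that \<open>(s u)\<^sup>2 = u s\<close>, so that the
  subgroup generated by \<open>s u\<close> consists of \<open>1\<close>, \<open>s u\<close> and \<open>u s\<close>.
\<close>

lemma radon_injective_if_involutions:
  assumes G: "group G"
    and s: "s \<in> carrier G" "s \<noteq> \<one>\<^bsub>G\<^esub>" "s \<otimes>\<^bsub>G\<^esub> s = \<one>\<^bsub>G\<^esub>"
    and u: "u \<in> carrier G" "u \<noteq> \<one>\<^bsub>G\<^esub>" "u \<otimes>\<^bsub>G\<^esub> u = \<one>\<^bsub>G\<^esub>"
    and neq: "s \<noteq> u"
    and braid: "s \<otimes>\<^bsub>G\<^esub> u \<otimes>\<^bsub>G\<^esub> s = u \<otimes>\<^bsub>G\<^esub> s \<otimes>\<^bsub>G\<^esub> u"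
  shows "radon_injective G"
  unfolding radon_injective_def
proof (intro allI impI ballI)
  interpret group G by (fact G)
  fix f :: "'a \<Rightarrow> complex" and x
  assume "\<forall>m\<ge>2. \<forall>x\<in>carrier G. \<forall>\<gamma>\<in>nontrivial_homs m G. radon G m f x \<gamma> = 0"
    and x: "x \<in> carrier G"
  then have powers: "(\<Sum>i<m. f (y \<otimes>\<^bsub>G\<^esub> g [^]\<^bsub>G\<^esub> i)) = 0"
    if "g \<in> carrier G" "g \<noteq> \<one>\<^bsub>G\<^esub>" "g [^]\<^bsub>G\<^esub> m = \<one>\<^bsub>G\<^esub>" "m \<ge> 2" "y \<in> carrier G"
    for g y and m :: nat
    using that by (intro sum_over_powers_eq_0) auto
  have flip: "f (y \<otimes>\<^bsub>G\<^esub> g) = - f y"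
    if "g \<in> carrier G" "g \<noteq> \<one>\<^bsub>G\<^esub>" "g \<otimes>\<^bsub>G\<^esub> g = \<one>\<^bsub>G\<^esub>" "y \<in> carrier G" for g y
    using powers [of g 2 y] that
    by (simp add: numeral_2_eq_2 add_eq_0_iff)
  define c where "c = s \<otimes>\<^bsub>G\<^esub> u"
  have c: "c \<in> carrier G"
    using s u by (simp add: c_def)
  have c_neq: "c \<noteq> \<one>\<^bsub>G\<^esub>"
    using inj_onD [OF inj_on_cmult [OF s(1)], of s u] s u neq by (auto simp: c_def)
  have c_square: "c \<otimes>\<^bsub>G\<^esub> c = u \<otimes>\<^bsub>G\<^esub> s"
  proof -
    have "c \<otimes>\<^bsub>G\<^esub> c = (s \<otimes>\<^bsub>G\<^esub> u \<otimes>\<^bsub>G\<^esub> s) \<otimes>\<^bsub>G\<^esub> u"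
      using s u by (simp add: c_def m_assoc)
    also have "\<dots> = u \<otimes>\<^bsub>G\<^esub> s \<otimes>\<^bsub>G\<^esub> (u \<otimes>\<^bsub>G\<^esub> u)"
      unfolding braid using s(1) u(1) by (simp add: m_assoc)
    finally show ?thesis
      using s u by simp
  qed
  have "c \<otimes>\<^bsub>G\<^esub> c \<otimes>\<^bsub>G\<^esub> c = u \<otimes>\<^bsub>G\<^esub> (s \<otimes>\<^bsub>G\<^esub> s) \<otimes>\<^bsub>G\<^esub> u"
    unfolding c_square using s(1) u(1) by (simp add: c_def m_assoc)
  then have "c [^]\<^bsub>G\<^esub> (3::nat) = \<one>\<^bsub>G\<^esub>"
    using s u c by (simp add: numeral_3_eq_3)
  then have "f x + f (x \<otimes>\<^bsub>G\<^esub> c) + f (x \<otimes>\<^bsub>G\<^esub> (c \<otimes>\<^bsub>G\<^esub> c)) = 0"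
    using powers [of c 3 x] c c_neq x by (simp add: numeral_3_eq_3)
  moreover have "f (x \<otimes>\<^bsub>G\<^esub> c) = f x" "f (x \<otimes>\<^bsub>G\<^esub> (c \<otimes>\<^bsub>G\<^esub> c)) = f x"
    using flip s u x unfolding c_square by (simp_all add: c_def flip: m_assoc)
  ultimately show "f x = 0"
    by simp
qed

theorem proposition5p2:
  fixes n :: nat
  assumes "n \<ge> 1"
  shows "radon_injective (sym_group n) \<longleftrightarrow> n \<ge> 3"
proof
  assume inj: "radon_injective (sym_group n)"
  show "n \<ge> 3"
  proof (rule ccontr)
    assume "\<not> n \<ge> 3"
    then have "{1..n} \<subseteq> {1, 2}"
      by auto
    then have perm: "p = id \<or> p = transpose 1 2" if "p permutes {1..n}" for p
      using permutes_subset [OF that] permutes_doubleton_iff [of p 1 2] by blast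
    have "\<not> radon_injective (sym_group n)"
    proof (rule not_radon_injective_if_faithful_character
        [OF sym_group_is_group, where \<chi> = "\<lambda>p. of_int (sign p)"])
      show "complex_of_int (sign (p \<otimes>\<^bsub>sym_group n\<^esub> q)) = of_int (sign p) * of_int (sign q)"
        if "p \<in> carrier (sym_group n)" "q \<in> carrier (sym_group n)" for p q
        using that [THEN sym_group_carrier'] by (simp add: sym_group_mult sign_compose)
      show "p = \<one>\<^bsub>sym_group n\<^esub>"
        if "p \<in> carrier (sym_group n)" "complex_of_int (sign p) = 1" for p
        using that perm [of p] by (auto simp: sym_group_carrier sym_group_one sign_swap_id)
    qed (simp add: sym_group_one)
    with inj show False
      by blast
  qed
next
  assume n: "n \<ge> 3"
  let ?s = "transpose 1 2 :: nat \<Rightarrow> nat" and ?u = "transpose 2 3 :: nat \<Rightarrow> nat"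
  show "radon_injective (sym_group n)"
  proof (rule radon_injective_if_involutions [OF sym_group_is_group, where s = ?s and u = ?u])
    show "?s \<in> carrier (sym_group n)" "?u \<in> carrier (sym_group n)"
      using n by (auto simp: sym_group_carrier intro!: permutes_swap_id)
    show "?s \<noteq> \<one>\<^bsub>sym_group n\<^esub>" "?u \<noteq> \<one>\<^bsub>sym_group n\<^esub>"
      by (auto dest: fun_cong [where x = 2] simp: sym_group_one transpose_def)
    show "?s \<otimes>\<^bsub>sym_group n\<^esub> ?s = \<one>\<^bsub>sym_group n\<^esub>"
      "?u \<otimes>\<^bsub>sym_group n\<^esub> ?u = \<one>\<^bsub>sym_group n\<^esub>"
      by (simp_all add: sym_group_mult sym_group_one)
    show "?s \<noteq> ?u"
      by (auto dest: fun_cong [where x = 1] simp: transpose_def)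
    show "?s \<otimes>\<^bsub>sym_group n\<^esub> ?u \<otimes>\<^bsub>sym_group n\<^esub> ?s
        = ?u \<otimes>\<^bsub>sym_group n\<^esub> ?s \<otimes>\<^bsub>sym_group n\<^esub> ?u"
      by (auto simp: sym_group_mult fun_eq_iff transpose_def)
  qed
qed

end
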